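(* Let $\Gamma$ be any 4-ary construction in which every vertex is assigned an eight-vertex constraint function whose parameter tuple $(a,b,c,d)$ satisfies $a+d\le b+c$, $b+d\le a+c$ and $c+d\le a+b$. Then the constraint function defined by $\Gamma$ is an eight-vertex constraint function whose parameters $(a',b',c',d')$ also satisfy $a'+d'\le b'+c'$, $b'+d'\le a'+c'$ and $c'+d'\le a'+b'$. That is, the set of eight-vertex constraint functions with parameters in $\mathcal{A}_\le\cap\mathcal{B}_\le\cap\mathcal{C}_\le$ is closed under 4-ary constructions.
   Context: An eight-vertex constraint function with parameters $(a,b,c,d)\in\mathbb{R}_{\ge 0}^4$ is the function $f:\{0,1\}^4\to\mathbb{R}_{\ge0}$ given by $f(0011)=f(1100)=a$, $f(0110)=f(1001)=b$, $f(0101)=f(1010)=c$, $f(0000)=f(1111)=d$, and $f(x)=0$ whenever $x$ has an odd number of ones. It is placed at a vertex whose four incident edge-ends are labeled $e_1,e_2,e_3,e_4$; given an orientation of the edges, the $i$-th input bit is $0$ if $e_i$ points into the vertex and $1$ if it points out. The regions are: $\mathcal{A}_\le=\{a+d\le b+c\}$, $\mathcal{B}_\le=\{b+d\le a+c\}$, $\mathcal{C}_\le=\{c+d\le a+b\}$ (as subsets of $\mathbb{R}_{\ge0}^4$). A 4-ary construction is a finite graph $\Gamma$ (multiple edges and loops allowed) together with four dangling edges $e_1,e_2,e_3,e_4$, each attached at one end to a vertex of $\Gamma$, such that every vertex has degree exactly $4$ (counting dangling edges and counting loops twice); at each vertex the four incident edge-ends are labeled $1,2,3,4$ and a constraint function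 is assigned. The constraint function $f$ defined by $\Gamma$ is the function on $\{0,1\}^4$ with $f(b_1b_2b_3b_4)=\sum_\sigma\prod_{v}f_v(\sigma|_v)$, the sum over all orientations $\sigma$ of the internal edges of $\Gamma$, where each dangling edge $e_i$ is oriented into $\Gamma$ if $b_i=0$ and out of $\Gamma$ if $b_i=1$, and $f_v(\sigma|_v)$ is the constraint function at $v$ evaluated on the induced local orientation. *)

theory Defs
  imports Complex_Main "HOL-Library.FuncSet" "HOL-Library.Numeral_Type"
begin

text \<open>
  Edge-ends at a vertex are labelled by the four-element type \<open>4\<close>, whose elements are the distinct
  values \<open>1\<close>, \<open>2\<close>, \<open>3\<close>, \<open>4\<close> (the last being equal to \<open>0\<close>).  Bits are booleans: \<open>False\<close> is the
  bit 0 (pointing into the vertex), \<open>True\<close> is the bit 1 (pointing out of it).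
\<close>

type_synonym constraint_fun = "(4 \<Rightarrow> bool) \<Rightarrow> real"

definition eight_vertex :: "real \<times> real \<times> real \<times> real \<Rightarrow> constraint_fun" where
  "eight_vertex = (\<lambda>(a, b, c, d) x.
     (let w = (x 1, x 2, x 3, x 4) in
      if w \<in> {(False, False, True, True), (True, True, False, False)} then a
      else if w \<in> {(False, True, True, False), (True, False, False, True)} then b
      else if w \<in> {(False, True, False, True), (True, False, True, False)} then c
      else if w \<in> {(False, False, False, False), (True, True, True, True)} then d
      else 0))"

definition nonneg4 :: "(real \<times> real \<times> real \<times> real) set" where
  "nonneg4 = {(a, b, c, d). 0 \<le> a \<and> 0 \<le> b \<and> 0 \<le> c \<and> 0 \<le> d}"

definition A_le :: "(real \<times> real \<times> real \<times> real) set" where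
  "A_le = {(a, b, c, d) \<in> nonneg4. a + d \<le> b + c}"

definition B_le :: "(real \<times> real \<times> real \<times> real) set" where
  "B_le = {(a, b, c, d) \<in> nonneg4. b + d \<le> a + c}"

definition C_le :: "(real \<times> real \<times> real \<times> real) set" where
  "C_le = {(a, b, c, d) \<in> nonneg4. c + d \<le> a + b}"

text \<open>
  An internal edge \<open>e\<close> has the two ends \<open>End1 e\<close> and \<open>End2 e\<close>; a loop is an edge whose two ends are
  attached to the same vertex.  The dangling edge \<open>e\<^sub>i\<close> has the single attached end \<open>Dangling i\<close>.
\<close>

datatype 'e edge_end = End1 'e | End2 'e | Dangling 4

record ('v, 'e) construction =
  vertices :: "'v set"
  edges :: "'e set"
  attach :: "'e edge_end \<Rightarrow> 'v"
  label :: "'e edge_end \<Rightarrow> 4"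
  constr :: "'v \<Rightarrow> constraint_fun"

definition edge_ends :: "('v, 'e) construction \<Rightarrow> 'e edge_end set" where
  "edge_ends G = End1 ` edges G \<union> End2 ` edges G \<union> range Dangling"

definition incident_ends :: "('v, 'e) construction \<Rightarrow> 'v \<Rightarrow> 'e edge_end set" where
  "incident_ends G v = {h \<in> edge_ends G. attach G h = v}"

text \<open>
  The bijectivity condition says that the edge-ends at each vertex carry the labels 1, 2, 3, 4, each
  exactly once; in particular every vertex has degree 4, with loops counted twice.
\<close>

definition four_ary_construction :: "('v, 'e) construction \<Rightarrow> bool" where
  "four_ary_construction G \<longleftrightarrow>
     finite (vertices G) \<and> finite (edges G) \<and>
     attach G ` edge_ends G \<subseteq> vertices G \<and>
     (\<forall>v\<in>vertices G. bij_betw (label G) (incident_ends G v) UNIV)"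

text \<open>
  An orientation of the internal edges is a function \<open>\<sigma>\<close> on them, where \<open>\<sigma> e\<close> means that \<open>e\<close> is
  directed from \<open>End1 e\<close> to \<open>End2 e\<close>.  A dangling edge directed into the graph points into the
  vertex it is attached to.
\<close>

fun points_out :: "('e \<Rightarrow> bool) \<Rightarrow> (4 \<Rightarrow> bool) \<Rightarrow> 'e edge_end \<Rightarrow> bool" where
  "points_out \<sigma> b (End1 e) = \<sigma> e"
| "points_out \<sigma> b (End2 e) = (\<not> \<sigma> e)"
| "points_out \<sigma> b (Dangling i) = b i"

definition local_orientation ::
  "('v, 'e) construction \<Rightarrow> ('e \<Rightarrow> bool) \<Rightarrow> (4 \<Rightarrow> bool) \<Rightarrow> 'v \<Rightarrow> 4 \<Rightarrow> bool" where
  "local_orientation G \<sigma> b v j =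
     points_out \<sigma> b (the_inv_into (incident_ends G v) (label G) j)"

definition defined_function :: "('v, 'e) construction \<Rightarrow> constraint_fun" where
  "defined_function G b =
     (\<Sum>\<sigma>\<in>edges G \<rightarrow>\<^sub>E UNIV. \<Prod>v\<in>vertices G. constr G v (local_orientation G \<sigma> b v))"

end

theory Submission
  imports Defs "HOL-Analysis.Cartesian_Space"
begin

text \<open>
  Apply the holographic transformation given by \<open>character\<close>.  An eight-vertex function with
  parameters \<open>(a, b, c, d)\<close> becomes an eight-vertex function whose parameters are, up to the factor
  \<open>1/8\<close>, \<open>b + c - a - d\<close>, \<open>a + c - b - d\<close>, \<open>a + b - c - d\<close> and \<open>a + b + c + d\<close>; hence the three
  inequalities say that the transform is nonnegative.  Under the transformation the disequality of
  the two ends of an edge becomes twice their equality, so the transform of the defined function is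
  a sum of products of the transformed vertex functions over edge colourings, which is
  nonnegative.  The parameter \<open>d\<close> of the defined function is itself a sum of nonnegative products, and
  together with the three inequalities this makes the other parameters nonnegative.
\<close>

section \<open>The change of basis and its effect on one vertex function\<close>

text \<open>The character (-1)^(xy) of the two-element group, twisted by \<open>\<i>\<close>^y.
  Without the twist an edge with both ends coloured y would get weight 2 (-1)^y; the two factors
  \<open>\<i>\<close>^y cancel this sign.\<close>

definition character :: "bool \<Rightarrow> bool \<Rightarrow> complex" where
  "character x y = (if y then (if x then - \<i> else \<i>) else 1)"

text \<open>Parity is kept multiplicative so that it can be regrouped from vertices to edges by the
  same product lemmas as the characters.\<close>

definition parity_sign :: "bool \<Rightarrow> real" where
  "parity_sign x = (if x then - 1 else 1)"

definition word4 :: "bool \<Rightarrow> bool \<Rightarrow> bool \<Rightarrow> bool \<Rightarrow> 4 \<Rightarrow> bool" where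
  "word4 p q r s j = (if j = 1 then p else if j = 2 then q else if j = 3 then r else s)"

lemma word4_simps [simp]:
  "word4 p q r s 1 = p" "word4 p q r s 2 = q" "word4 p q r s 3 = r" "word4 p q r s 4 = s"
  by (auto simp: word4_def)

lemma word4_eta: "word4 (x 1) (x 2) (x 3) (x 4) = x"
proof
  fix j show "word4 (x 1) (x 2) (x 3) (x 4) j = x j"
    using exhaust_4[of j] by auto
qed

lemma not_word4: "(\<lambda>j. \<not> word4 p q r s j) = word4 (\<not> p) (\<not> q) (\<not> r) (\<not> s)"
  by (auto simp: word4_def fun_eq_iff)

lemma prod_4: "prod f (UNIV :: 4 set) = f 1 * f 2 * f 3 * (f 4 :: 'a :: comm_monoid_mult)"
  unfolding UNIV_4 by (simp add: ac_simps)

lemma sum_word4: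
  fixes F :: "(4 \<Rightarrow> bool) \<Rightarrow> 'a :: comm_monoid_add"
  shows "(\<Sum>y\<in>UNIV. F y) = (\<Sum>p\<in>UNIV. \<Sum>q\<in>UNIV. \<Sum>r\<in>UNIV. \<Sum>s\<in>UNIV. F (word4 p q r s))"
proof -
  have "(\<Sum>y\<in>UNIV. F y) = (\<Sum>(p, q, r, s)\<in>UNIV. F (word4 p q r s))"
    by (rule sum.reindex_bij_witness[of _ "\<lambda>(p, q, r, s). word4 p q r s"
          "\<lambda>x. (x 1, x 2, x 3, x 4)"]) (auto simp: word4_eta)
  then show ?thesis
    by (simp add: sum.cartesian_product flip: UNIV_Times_UNIV)
qed

lemma eight_vertex_word4:
  "eight_vertex (a, b, c, d) (word4 p q r s) =
    (if p = q then (if r = s then (if p = r then d else a) else 0)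
     else if r = s then 0 else if p = r then c else b)"
  by (simp add: eight_vertex_def Let_def)

text \<open>For y of even weight the twist contributes 1 at weight 0 or 4 and -1 at weight 2, and
  the remaining sign is (-1)^(x.y). Complementary words y agree in sign if x is even, whence the
  factor 2, and cancel if x is odd.\<close>

lemma eight_vertex_transform:
  "(\<Sum>y\<in>UNIV. complex_of_real (eight_vertex (A, B, C, D) y) * (\<Prod>j\<in>UNIV. character (x j) (y j)))
    = complex_of_real (eight_vertex
        (2 * (D - A + B + C), 2 * (D + A - B + C), 2 * (D + A + B - C), 2 * (D - A - B - C)) x)"
proof -
  have "(\<Sum>y\<in>UNIV. complex_of_real (eight_vertex (A, B, C, D) y) *
          (\<Prod>j\<in>UNIV. character (word4 p q r s j) (y j)))
    = complex_of_real (eight_vertex (2 * (D - A + B + C), 2 * (D + A - B + C),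
        2 * (D + A + B - C), 2 * (D - A - B - C)) (word4 p q r s))" for p q r s
    unfolding sum_word4 prod_4
    by (cases p; cases q; cases r; cases s)
       (simp_all add: UNIV_bool eight_vertex_word4 character_def)
  from this[of "x 1" "x 2" "x 3" "x 4"] show ?thesis
    by (simp add: word4_eta)
qed

lemma eight_vertex_nonneg:
  "p \<in> nonneg4 \<Longrightarrow> 0 \<le> eight_vertex p x"
  by (auto simp: eight_vertex_def nonneg4_def Let_def)

lemma eight_vertex_complement: "eight_vertex p (\<lambda>j. \<not> x j) = eight_vertex p x"
  by (cases p) (auto simp: eight_vertex_def Let_def)

lemma eight_vertex_odd: "(\<Prod>j\<in>UNIV. parity_sign (x j)) \<noteq> 1 \<Longrightarrow> eight_vertex p x = 0"
  by (cases p; cases "x 1"; cases "x 2"; cases "x 3"; cases "x 4")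
     (simp_all add: prod_4 eight_vertex_def Let_def parity_sign_def)

text \<open>The eight even words form four complementary pairs, and one value per pair is a
  parameter.\<close>

lemma eight_vertex_if_even_symmetric:
  assumes odd: "\<And>x. (\<Prod>j\<in>UNIV. parity_sign (x j)) \<noteq> 1 \<Longrightarrow> g x = 0"
    and complement: "\<And>x. g (\<lambda>j. \<not> x j) = g x"
  shows "g = eight_vertex (g (word4 False False True True), g (word4 False True True False),
    g (word4 False True False True), g (word4 False False False False))"
    (is "g = eight_vertex ?p")
proof -
  have "g (word4 p q r s) = eight_vertex ?p (word4 p q r s)" for p q r s
    using odd[of "word4 p q r s"] complement[of "word4 p q r s"]
    by (cases p; cases q; cases r; cases s)
       (simp_all add: prod_4 eight_vertex_def Let_def parity_sign_def not_word4)
  then have "g x = eight_vertex ?p x" for x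
    by (subst (1 2) word4_eta[of x, symmetric])
  then show ?thesis
    by (rule ext)
qed

text \<open>The ends of an internal edge carry opposite bits, so this is the weight of one edge
  after its two orientations are summed out.\<close>

lemma sum_character_edge:
  "(\<Sum>s\<in>UNIV. character s y * character (\<not> s) z) = 2 * of_bool (y = z)"
  by (cases y; cases z) (simp_all add: UNIV_bool character_def)

section \<open>Regrouping products over vertices as products over edges\<close>

text \<open>Each edge-end has one vertex and one label there, and each label occurs once at each
  vertex, so vertex-label pairs correspond bijectively to edge-ends.\<close>

lemma prod_vertex_labels:
  fixes F :: "'v \<Rightarrow> 4 \<Rightarrow> 'e edge_end \<Rightarrow> 'a :: comm_monoid_mult"
  assumes G: "four_ary_construction G"
  shows "(\<Prod>v\<in>vertices G. \<Prod>j\<in>UNIV. F v j (the_inv_into (incident_ends G v) (label G) j))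
    = (\<Prod>h\<in>edge_ends G. F (attach G h) (label G h) h)"
proof -
  have fin: "finite (edge_ends G)" "finite (vertices G)"
    and att: "attach G ` edge_ends G \<subseteq> vertices G"
    and bij: "\<And>v. v \<in> vertices G \<Longrightarrow> bij_betw (label G) (incident_ends G v) UNIV"
    using G by (auto simp: four_ary_construction_def edge_ends_def)
  have "(\<Prod>j\<in>UNIV. F v j (the_inv_into (incident_ends G v) (label G) j))
      = (\<Prod>h\<in>{h \<in> edge_ends G. attach G h = v}. F (attach G h) (label G h) h)"
    if v: "v \<in> vertices G" for v
  proof -
    have "(\<Prod>j\<in>UNIV. F v j (the_inv_into (incident_ends G v) (label G) j))
        = (\<Prod>h\<in>incident_ends G v.
            F v (label G h) (the_inv_into (incident_ends G v) (label G) (label G h)))"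
      by (rule prod.reindex_bij_betw[OF bij[OF v], symmetric])
    also have "\<dots> = (\<Prod>h\<in>incident_ends G v. F (attach G h) (label G h) h)"
      using bij[OF v]
      by (intro prod.cong) (auto simp: bij_betw_def the_inv_into_f_f incident_ends_def)
    finally show ?thesis
      by (simp add: incident_ends_def)
  qed
  then have "(\<Prod>v\<in>vertices G. \<Prod>j\<in>UNIV. F v j (the_inv_into (incident_ends G v) (label G) j))
      = (\<Prod>v\<in>vertices G. \<Prod>h\<in>{h \<in> edge_ends G. attach G h = v}. F (attach G h) (label G h) h)"
    by (rule prod.cong[OF refl])
  also have "\<dots> = (\<Prod>h\<in>edge_ends G. F (attach G h) (label G h) h)"
    by (rule prod.group[OF fin att])
  finally show ?thesis .
qed

lemma prod_edge_ends:
  fixes H :: "'e edge_end \<Rightarrow> 'a :: comm_monoid_mult"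
  assumes "finite (edges G)"
  shows "(\<Prod>h\<in>edge_ends G. H h)
    = (\<Prod>e\<in>edges G. H (End1 e) * H (End2 e)) * (\<Prod>i\<in>UNIV. H (Dangling i))"
proof -
  have "(\<Prod>h\<in>edge_ends G. H h) = (\<Prod>h\<in>End1 ` edges G. H h) * (\<Prod>h\<in>End2 ` edges G. H h)
      * (\<Prod>h\<in>range Dangling. H h)"
    unfolding edge_ends_def using assms
    by (subst prod.union_disjoint; (subst prod.union_disjoint)?; auto)
  then show ?thesis
    by (simp add: prod.reindex inj_on_def prod.distrib)
qed

section \<open>The transform as a sum over colourings\<close>

text \<open>\<open>Y\<close> picks a word at every vertex independently, so the two ends of an edge
  may differ in colour; only the edge factors below force agreement.\<close>

definition end_colour :: "('v, 'e) construction \<Rightarrow> ('v \<Rightarrow> 4 \<Rightarrow> bool) \<Rightarrow> 'e edge_end \<Rightarrow> bool" where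
  "end_colour G Y h = Y (attach G h) (label G h)"

definition colouring_function ::
  "('v, 'e) construction \<Rightarrow> ('v \<Rightarrow> constraint_fun) \<Rightarrow> constraint_fun" where
  "colouring_function G g y =
    (\<Sum>Y\<in>vertices G \<rightarrow>\<^sub>E UNIV. of_bool (y = (\<lambda>i. end_colour G Y (Dangling i))) *
      ((\<Prod>v\<in>vertices G. g v (Y v)) *
       (\<Prod>e\<in>edges G. 2 * of_bool (end_colour G Y (End1 e) = end_colour G Y (End2 e)))))"

lemma of_real_of_bool: "of_real (of_bool P) = of_bool P"
  by (cases P) simp_all

lemma defined_function_transform:
  assumes G: "four_ary_construction G"
    and g: "\<And>v x. v \<in> vertices G \<Longrightarrow> complex_of_real (constr G v x) =
      (\<Sum>y\<in>UNIV. complex_of_real (g v y) * (\<Prod>j\<in>UNIV. character (x j) (y j)))"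
  shows "complex_of_real (defined_function G b) =
    (\<Sum>y\<in>UNIV. complex_of_real (colouring_function G g y) * (\<Prod>i\<in>UNIV. character (b i) (y i)))"
proof -
  have fin: "finite (edges G)" "finite (vertices G)"
    using G by (auto simp: four_ary_construction_def)
  let ?\<Y> = "vertices G \<rightarrow>\<^sub>E (UNIV :: (4 \<Rightarrow> bool) set)"
  let ?c = "end_colour G"
  let ?dangling = "\<lambda>Y. \<Prod>i\<in>UNIV. character (b i) (?c Y (Dangling i))"
  let ?w = "\<lambda>Y. complex_of_real (\<Prod>v\<in>vertices G. g v (Y v))"
  let ?eq = "\<lambda>Y. \<Prod>e\<in>edges G. 2 * of_bool (?c Y (End1 e) = ?c Y (End2 e))"
  have characters: "(\<Prod>v\<in>vertices G. \<Prod>j\<in>UNIV. character (local_orientation G \<sigma> b v j) (Y v j))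
      = (\<Prod>e\<in>edges G. character (\<sigma> e) (?c Y (End1 e)) * character (\<not> \<sigma> e) (?c Y (End2 e)))
        * ?dangling Y" for \<sigma> Y
    unfolding local_orientation_def
    by (subst prod_vertex_labels[OF G, of "\<lambda>v j h. character (points_out \<sigma> b h) (Y v j)"])
       (simp add: prod_edge_ends[OF fin(1)] end_colour_def)
  have "complex_of_real (defined_function G b) =
      (\<Sum>\<sigma>\<in>edges G \<rightarrow>\<^sub>E UNIV. \<Prod>v\<in>vertices G. \<Sum>y\<in>UNIV. complex_of_real (g v y) *
        (\<Prod>j\<in>UNIV. character (local_orientation G \<sigma> b v j) (y j)))"
    by (simp add: defined_function_def g)
  also have "\<dots> = (\<Sum>\<sigma>\<in>edges G \<rightarrow>\<^sub>E UNIV. \<Sum>Y\<in>?\<Y>. \<Prod>v\<in>vertices G. complex_of_real (g v (Y v)) *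
        (\<Prod>j\<in>UNIV. character (local_orientation G \<sigma> b v j) (Y v j)))"
    using fin by (subst prod_sum_PiE) auto
  also have "\<dots> = (\<Sum>Y\<in>?\<Y>. \<Sum>\<sigma>\<in>edges G \<rightarrow>\<^sub>E UNIV. \<Prod>v\<in>vertices G. complex_of_real (g v (Y v)) *
        (\<Prod>j\<in>UNIV. character (local_orientation G \<sigma> b v j) (Y v j)))"
    by (rule sum.swap)
  \<comment> \<open>For fixed \<open>Y\<close> the orientation enters only through the internal
    edges, by \<open>characters\<close>.\<close>
  also have "\<dots> = (\<Sum>Y\<in>?\<Y>. ?w Y * ?dangling Y * (\<Sum>\<sigma>\<in>edges G \<rightarrow>\<^sub>E UNIV.
        \<Prod>e\<in>edges G. character (\<sigma> e) (?c Y (End1 e)) * character (\<not> \<sigma> e) (?c Y (End2 e))))"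
    by (simp add: prod.distrib[of "\<lambda>v. complex_of_real (g v _)"] characters sum_distrib_left
        mult_ac prod.distrib)
  \<comment> \<open>The sum over orientations factorises into one two-term sum per edge.\<close>
  also have "\<dots> = (\<Sum>Y\<in>?\<Y>. ?w Y * ?dangling Y * ?eq Y)"
    using fin by (subst prod_sum_PiE[symmetric]) (auto simp: sum_character_edge)
  \<comment> \<open>A sum over y with a single nonzero term is inserted, so that the colourings can
    be grouped by their dangling word.\<close>
  also have "\<dots> = (\<Sum>Y\<in>?\<Y>. \<Sum>y\<in>UNIV. of_bool (y = (\<lambda>i. ?c Y (Dangling i))) *
        (?w Y * ?eq Y) * (\<Prod>i\<in>UNIV. character (b i) (y i)))"
  proof (rule sum.cong[OF refl])
    fix Y
    have "(\<Sum>y\<in>UNIV. of_bool (y = (\<lambda>i. ?c Y (Dangling i))) *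
          (?w Y * ?eq Y) * (\<Prod>i\<in>UNIV. character (b i) (y i)))
        = (\<Sum>y\<in>UNIV. if y = (\<lambda>i. ?c Y (Dangling i))
            then ?w Y * ?eq Y * (\<Prod>i\<in>UNIV. character (b i) (y i)) else 0)"
      by (rule sum.cong) auto
    then show "?w Y * ?dangling Y * ?eq Y = (\<Sum>y\<in>UNIV. of_bool (y = (\<lambda>i. ?c Y (Dangling i))) *
          (?w Y * ?eq Y) * (\<Prod>i\<in>UNIV. character (b i) (y i)))"
      by (simp add: mult_ac)
  qed
  also have "\<dots> = (\<Sum>y\<in>UNIV. complex_of_real (colouring_function G g y) *
        (\<Prod>i\<in>UNIV. character (b i) (y i)))"
    by (subst sum.swap) (simp add: colouring_function_def sum_distrib_right of_real_of_bool)
  finally show ?thesis .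
qed

section \<open>Sign, parity and symmetry of the colouring sum\<close>

lemma colouring_function_nonneg:
  assumes "\<And>v y. v \<in> vertices G \<Longrightarrow> 0 \<le> g v y"
  shows "0 \<le> colouring_function G g y"
  unfolding colouring_function_def
  by (intro sum_nonneg mult_nonneg_nonneg prod_nonneg) (auto simp: assms)

text \<open>In a nonzero term every vertex word is even, so the signs of all edge-ends multiply to
  1. The equal signs at the ends of each internal edge cancel, which leaves the dangling word
  even.\<close>

lemma colouring_function_odd:
  assumes G: "four_ary_construction G"
    and odd: "\<And>v y. v \<in> vertices G \<Longrightarrow> (\<Prod>j\<in>UNIV. parity_sign (y j)) \<noteq> 1 \<Longrightarrow> g v y = 0"
    and y: "(\<Prod>i\<in>UNIV. parity_sign (y i)) \<noteq> 1"
  shows "colouring_function G g y = 0"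
  unfolding colouring_function_def
proof (intro sum.neutral ballI)
  fix Y
  have fin: "finite (edges G)" "finite (vertices G)"
    using G by (auto simp: four_ary_construction_def)
  let ?c = "end_colour G Y"
  show "of_bool (y = (\<lambda>i. ?c (Dangling i))) * ((\<Prod>v\<in>vertices G. g v (Y v)) *
       (\<Prod>e\<in>edges G. 2 * of_bool (?c (End1 e) = ?c (End2 e)))) = 0"
  proof (rule ccontr)
    assume "\<not> ?thesis"
    then have dangling: "y = (\<lambda>i. ?c (Dangling i))"
      and vertex: "\<And>v. v \<in> vertices G \<Longrightarrow> g v (Y v) \<noteq> 0"
      and edge: "\<And>e. e \<in> edges G \<Longrightarrow> ?c (End1 e) = ?c (End2 e)"
      using fin by (auto simp: of_bool_def split: if_splits)
    have "1 = (\<Prod>v\<in>vertices G. \<Prod>j\<in>UNIV. parity_sign (Y v j))"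
      using odd vertex by (intro prod.neutral[symmetric]) blast
    also have "\<dots> = (\<Prod>e\<in>edges G. parity_sign (?c (End1 e)) * parity_sign (?c (End2 e)))
        * (\<Prod>i\<in>UNIV. parity_sign (?c (Dangling i)))"
      by (subst prod_vertex_labels[OF G, of "\<lambda>v j h. parity_sign (Y v j)"])
         (simp add: prod_edge_ends[OF fin(1)] end_colour_def)
    also have "(\<Prod>e\<in>edges G. parity_sign (?c (End1 e)) * parity_sign (?c (End2 e))) = 1"
      by (rule prod.neutral) (simp add: edge parity_sign_def)
    finally show False
      using y dangling by simp
  qed
qed

text \<open>Flipping every colour is an involution on colourings that preserves agreement along
  edges and complements the dangling word.\<close>

lemma colouring_function_complement:
  assumes G: "four_ary_construction G"
    and complement: "\<And>v y. v \<in> vertices G \<Longrightarrow> g v (\<lambda>j. \<not> y j) = g v y"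
  shows "colouring_function G g (\<lambda>i. \<not> y i) = colouring_function G g y"
proof -
  \<comment> \<open>The restriction to \<open>vertices G\<close> keeps the flipped colouring
    extensional; it loses nothing, as all edge-ends are attached there.\<close>
  let ?n = "\<lambda>Y. \<lambda>v\<in>vertices G. \<lambda>j :: 4. \<not> Y v j"
  have "attach G h \<in> vertices G" if "h \<in> edge_ends G" for h
    using G that by (auto simp: four_ary_construction_def)
  then have ends: "end_colour G (?n Y) h \<longleftrightarrow> \<not> end_colour G Y h" if "h \<in> edge_ends G" for Y h
    using that by (simp add: end_colour_def)
  have dangling: "end_colour G (?n Y) (Dangling i) \<longleftrightarrow> \<not> end_colour G Y (Dangling i)" for Y i
    by (rule ends) (simp add: edge_ends_def)
  have edge: "(end_colour G (?n Y) (End1 e) = end_colour G (?n Y) (End2 e)) \<longleftrightarrow>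
      (end_colour G Y (End1 e) = end_colour G Y (End2 e))" if "e \<in> edges G" for Y e
    using that ends[of "End1 e" Y] ends[of "End2 e" Y] by (auto simp: edge_ends_def)
  have involution: "?n (?n Y) = Y" if "Y \<in> vertices G \<rightarrow>\<^sub>E UNIV" for Y
    using that by (auto simp: fun_eq_iff PiE_def extensional_def)
  show ?thesis
    unfolding colouring_function_def
  proof (rule sum.reindex_bij_witness[of _ ?n ?n])
    fix Y :: "'a \<Rightarrow> 4 \<Rightarrow> bool"
    assume Y: "Y \<in> vertices G \<rightarrow>\<^sub>E UNIV"
    show "?n (?n Y) = Y" "?n (?n Y) = Y" using involution[OF Y] by simp_all
    show "?n Y \<in> vertices G \<rightarrow>\<^sub>E UNIV" "?n Y \<in> vertices G \<rightarrow>\<^sub>E UNIV" by auto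
    have "(y = (\<lambda>i. end_colour G (?n Y) (Dangling i))) \<longleftrightarrow>
        ((\<lambda>i. \<not> y i) = (\<lambda>i. end_colour G Y (Dangling i)))"
      unfolding dangling by (auto simp: fun_eq_iff)
    moreover have "(\<Prod>v\<in>vertices G. g v (?n Y v)) = (\<Prod>v\<in>vertices G. g v (Y v))"
      by (rule prod.cong) (simp_all add: complement)
    moreover have
      "(\<Prod>e\<in>edges G. 2 * of_bool (end_colour G (?n Y) (End1 e) = end_colour G (?n Y) (End2 e)))
        = (\<Prod>e\<in>edges G. 2 * of_bool (end_colour G Y (End1 e) = end_colour G Y (End2 e)) :: real)"
      by (rule prod.cong) (simp_all only: edge)
    ultimately show
      "of_bool (y = (\<lambda>i. end_colour G (?n Y) (Dangling i))) *
        ((\<Prod>v\<in>vertices G. g v (?n Y v)) * (\<Prod>e\<in>edges G.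
          2 * of_bool (end_colour G (?n Y) (End1 e) = end_colour G (?n Y) (End2 e)))) =
       of_bool ((\<lambda>i. \<not> y i) = (\<lambda>i. end_colour G Y (Dangling i))) *
        ((\<Prod>v\<in>vertices G. g v (Y v)) * (\<Prod>e\<in>edges G.
          2 * of_bool (end_colour G Y (End1 e) = end_colour G Y (End2 e))) :: real)"
      by simp
  qed
qed

section \<open>The three inequalities as nonnegativity of the transform\<close>

lemma nonneg_transform_exists:
  assumes "p \<in> A_le \<inter> B_le \<inter> C_le"
  shows "\<exists>q\<in>nonneg4. \<forall>x. complex_of_real (eight_vertex p x) =
    (\<Sum>y\<in>UNIV. complex_of_real (eight_vertex q y) * (\<Prod>j\<in>UNIV. character (x j) (y j)))"
proof -
  obtain a b c d where p: "p = (a, b, c, d)"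
    by (cases p) auto
  \<comment> \<open>The parameter map in \<open>eight_vertex_transform\<close> is 2M, where M has
    entries 1 and -1 and orthogonal rows of squared norm 4. Its inverse is therefore the transpose
    of M divided by 8.\<close>
  let ?q = "((b + c - a - d) / 8, (a + c - b - d) / 8, (a + b - c - d) / 8, (a + b + c + d) / 8)"
  have "?q \<in> nonneg4"
    using assms by (auto simp: p A_le_def B_le_def C_le_def nonneg4_def)
  moreover have "complex_of_real (eight_vertex p x) =
      (\<Sum>y\<in>UNIV. complex_of_real (eight_vertex ?q y) * (\<Prod>j\<in>UNIV. character (x j) (y j)))" for x
    unfolding eight_vertex_transform p
    by (intro arg_cong[of _ _ "\<lambda>p. complex_of_real (eight_vertex p x)"]) (simp add: field_simps)
  ultimately show ?thesis
    by blast
qed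

theorem mainTheorem2:
  fixes \<Gamma> :: "('v, 'e) construction"
  assumes "four_ary_construction \<Gamma>"
    and "\<forall>v\<in>vertices \<Gamma>. \<exists>p \<in> A_le \<inter> B_le \<inter> C_le. constr \<Gamma> v = eight_vertex p"
  shows "\<exists>p' \<in> A_le \<inter> B_le \<inter> C_le. defined_function \<Gamma> = eight_vertex p'"
proof -
  let ?T = "\<lambda>q x. \<Sum>y\<in>UNIV. complex_of_real (eight_vertex q y) *
    (\<Prod>j\<in>UNIV. character (x j) (y j))"
  have "\<forall>v\<in>vertices \<Gamma>. \<exists>q. q \<in> nonneg4 \<and> (\<forall>x. complex_of_real (constr \<Gamma> v x) = ?T q x)"
  proof
    fix v assume "v \<in> vertices \<Gamma>"
    then obtain p where "p \<in> A_le \<inter> B_le \<inter> C_le" "constr \<Gamma> v = eight_vertex p"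
      using assms(2) by blast
    then show "\<exists>q. q \<in> nonneg4 \<and> (\<forall>x. complex_of_real (constr \<Gamma> v x) = ?T q x)"
      using nonneg_transform_exists[of p] by auto
  qed
  from bchoice[OF this] obtain q where q: "\<And>v. v \<in> vertices \<Gamma> \<Longrightarrow> q v \<in> nonneg4"
    and constr: "\<And>v x. v \<in> vertices \<Gamma> \<Longrightarrow> complex_of_real (constr \<Gamma> v x) = ?T (q v) x"
    by blast
  let ?g = "colouring_function \<Gamma> (\<lambda>v. eight_vertex (q v))"
  have g_nonneg: "0 \<le> ?g y" for y
    using q by (intro colouring_function_nonneg eight_vertex_nonneg)
  obtain A B C D where g: "?g = eight_vertex (A, B, C, D)"
    and nonneg: "0 \<le> A" "0 \<le> B" "0 \<le> C" "0 \<le> D"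
  proof -
    have "?g = eight_vertex (?g (word4 False False True True), ?g (word4 False True True False),
        ?g (word4 False True False True), ?g (word4 False False False False))"
      by (intro eight_vertex_if_even_symmetric colouring_function_odd[OF assms(1)]
          colouring_function_complement[OF assms(1)] eight_vertex_odd eight_vertex_complement)
    then show ?thesis
      using that g_nonneg by blast
  qed
  \<comment> \<open>With p = (a, b, c, d), the slacks b + c - a - d, a + c - b - d and a + b - c - d
    are \<open>8 * A\<close>, \<open>8 * B\<close> and \<open>8 * C\<close>.\<close>
  define p where
    "p = (2 * (D - A + B + C), 2 * (D + A - B + C), 2 * (D + A + B - C), 2 * (D - A - B - C))"
  have f: "defined_function \<Gamma> = eight_vertex p"
  proof
    fix x
    have "complex_of_real (defined_function \<Gamma> x) =
        (\<Sum>y\<in>UNIV. complex_of_real (?g y) * (\<Prod>i\<in>UNIV. character (x i) (y i)))"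
      using assms(1) constr by (rule defined_function_transform)
    also have "\<dots> = complex_of_real (eight_vertex p x)"
      unfolding g p_def by (rule eight_vertex_transform)
    finally have "complex_of_real (defined_function \<Gamma> x) = complex_of_real (eight_vertex p x)" .
    then show "defined_function \<Gamma> x = eight_vertex p x"
      by simp
  qed
  \<comment> \<open>Nonnegativity of \<open>A\<close>, \<open>B\<close>, \<open>C\<close>,
    \<open>D\<close> does not bound the last parameter of \<open>p\<close> from below, so its sign
    is taken from the original sum over orientations.\<close>
  have "0 \<le> constr \<Gamma> v x" if v: "v \<in> vertices \<Gamma>" for v x
  proof -
    obtain p where "p \<in> A_le" "constr \<Gamma> v = eight_vertex p"
      using assms(2) v by blast
    moreover from this(1) have "p \<in> nonneg4"
      by (auto simp: A_le_def)
    ultimately show ?thesis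
      by (simp add: eight_vertex_nonneg)
  qed
  then have "0 \<le> defined_function \<Gamma> (word4 False False False False)"
    unfolding defined_function_def by (intro sum_nonneg prod_nonneg) auto
  then have "0 \<le> D - A - B - C"
    by (simp add: f p_def eight_vertex_def)
  \<comment> \<open>From \<open>D - A \<ge> B + C\<close> the first parameter is at least
    \<open>4 * (B + C)\<close>, and similarly for the second and third.\<close>
  then have "p \<in> A_le \<inter> B_le \<inter> C_le"
    using nonneg by (simp add: p_def A_le_def B_le_def C_le_def nonneg4_def)
  then show ?thesis
    using f by blast
qed

end
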